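(* Let $n\ge 2$ be an integer. There exist a Lipschitz continuous and strictly increasing function $f:\mathbb{R}\to(0,+\infty)$, a set $\Omega\subset\mathbb{R}^n$ which is open, bounded, simply connected, different from a ball, and has boundary $\partial\Omega$ globally of class $\mathcal{C}^\infty$, a subset $\Gamma\subset\partial\Omega$ which is nonempty, connected, relatively open in $\partial\Omega$ and included in a sphere of $\mathbb{R}^n$, and a function $u\in\mathcal{C}^2(\overline{\Omega})$ such that $$\left\{\begin{array}{ll}-\Delta u=f(u) & \text{in }\Omega,\\ |\nabla u|=8 & \text{on }\partial\Omega,\\ u=0 & \text{on }\Gamma.\end{array}\right.$$
   Context: Simply connected sets are understood to be nonempty and connected. A sphere of $\mathbb{R}^n$ is a set $\{x\in\mathbb{R}^n : |x-x_0|=r\}$ with $x_0\in\mathbb{R}^n$, $r>0$. The notation $u\in\mathcal{C}^2(\overline{\Omega})$ means that $u$ is of class $\mathcal{C}^2$ in $\Omega$ with $u$ and its derivatives up to order 2 extending continuously to $\overline{\Omega}$. *)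

theory Defs
  imports "HOL-Analysis.Analysis"
begin

definition partial_derivative :: "'a::euclidean_space \<Rightarrow> ('a \<Rightarrow> 'b::real_normed_vector) \<Rightarrow> 'a \<Rightarrow> 'b"
  where "partial_derivative b f x = frechet_derivative f (at x) b"

definition gradient :: "('a::euclidean_space \<Rightarrow> real) \<Rightarrow> 'a \<Rightarrow> 'a"
  where "gradient u x = (\<Sum>b\<in>Basis. partial_derivative b u x *\<^sub>R b)"

definition laplacian :: "('a::euclidean_space \<Rightarrow> real) \<Rightarrow> 'a \<Rightarrow> real"
  where "laplacian u x = (\<Sum>b\<in>Basis. partial_derivative b (partial_derivative b u) x)"

(* Class C^k on a set S, meant for open S: derivatives are taken in the full space. *)
fun Ck_on :: "nat \<Rightarrow> ('a::euclidean_space \<Rightarrow> 'b::real_normed_vector) \<Rightarrow> 'a set \<Rightarrow> bool"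
  where
    "Ck_on 0 f S \<longleftrightarrow> continuous_on S f"
  | "Ck_on (Suc k) f S \<longleftrightarrow>
       (\<forall>x\<in>S. f differentiable (at x)) \<and> (\<forall>b\<in>Basis. Ck_on k (partial_derivative b f) S)"

definition smooth_on :: "('a::euclidean_space \<Rightarrow> 'b::real_normed_vector) \<Rightarrow> 'a set \<Rightarrow> bool"
  where "smooth_on f S \<longleftrightarrow> (\<forall>k. Ck_on k f S)"

definition extends_to_closure :: "('a::topological_space \<Rightarrow> 'b::topological_space) \<Rightarrow> 'a set \<Rightarrow> bool"
  where "extends_to_closure f S \<longleftrightarrow>
    (\<exists>g. continuous_on (closure S) g \<and> (\<forall>x\<in>S. g x = f x))"

(* The class C^2 on the closure of the open set S. The values of u on the frontier are those of
   its continuous extension, so u itself is required to be continuous on the closure. The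
   derivatives are only meaningful in S; their extensions are separate functions. *)
definition C2_closure :: "('a::euclidean_space \<Rightarrow> real) \<Rightarrow> 'a set \<Rightarrow> bool"
  where "C2_closure u S \<longleftrightarrow>
    Ck_on 2 u S \<and> continuous_on (closure S) u \<and>
    (\<forall>b\<in>Basis. extends_to_closure (partial_derivative b u) S) \<and>
    (\<forall>b\<in>Basis. \<forall>c\<in>Basis. extends_to_closure (partial_derivative c (partial_derivative b u)) S)"

(* The gradient of u at a frontier point x of the open set S is the value at x of the continuous
   extension of the interior gradient. The limit exists and is unique when C2_closure u S. *)
definition boundary_gradient :: "('a::euclidean_space \<Rightarrow> real) \<Rightarrow> 'a set \<Rightarrow> 'a \<Rightarrow> 'a"
  where "boundary_gradient u S x = Lim (at x within S) (gradient u)"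

(* Boundary of class C-infinity, by local straightening: around each boundary point a smooth
   diffeomorphism with smooth inverse maps S to an open half-space and the boundary to the
   bounding hyperplane. In particular S lies locally on one side of its boundary. *)
definition smooth_boundary :: "'a::euclidean_space set \<Rightarrow> bool"
  where "smooth_boundary S \<longleftrightarrow>
    (\<forall>p\<in>frontier S. \<exists>U V. \<exists>(\<phi> :: 'a \<Rightarrow> 'a) (\<psi> :: 'a \<Rightarrow> 'a). \<exists>b\<in>Basis.
       open U \<and> p \<in> U \<and> open V \<and>
       homeomorphism U V \<phi> \<psi> \<and> smooth_on \<phi> U \<and> smooth_on \<psi> V \<and>
       \<phi> ` (U \<inter> S) = V \<inter> {y. 0 < y \<bullet> b} \<and>
       \<phi> ` (U \<inter> frontier S) = V \<inter> {y. y \<bullet> b = 0})"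

end

theory Submission
  imports Defs
begin

text \<open>The function \<open>u x = 8 * (1 - norm x)\<close> has gradient of norm 8 everywhere off the origin, and
  \<open>- \<Delta>u = 8 * (n - 1) / norm x\<close> is an increasing function of \<open>u\<close>. It therefore suffices to find a smooth
  simply connected domain whose closure avoids the origin and whose boundary contains a cap of the
  unit sphere. Such a domain is the image of the unit ball under a shear \<open>x + g (x \<bullet> e) d\<close> in a
  direction \<open>d\<close> orthogonal to \<open>e\<close>, where the smooth function \<open>g\<close> vanishes on \<open>[1/2, \<infinity>)\<close> and
  \<open>g 0 = 2\<close>: the cap \<open>x \<bullet> e > 1/2\<close> is kept, while the origin is left outside.\<close>

section \<open>Calculus of functions of class C^k\<close>

lemma partial_derivative_eqI:
  assumes "(f has_derivative D) (at x)"
  shows "partial_derivative b f x = D b"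
  using frechet_derivative_at[OF assms] by (simp add: partial_derivative_def)

text \<open>On an open set, agreement of two functions passes to their derivatives, so the induction
  applies to each partial derivative.\<close>

lemma Ck_on_cong:
  assumes "open S" "\<And>x. x \<in> S \<Longrightarrow> f x = g x" "Ck_on k f S"
  shows "Ck_on k g S"
  using assms(2,3)
proof (induction k arbitrary: f g)
  case 0
  then show ?case by (simp cong: continuous_on_cong)
next
  case (Suc k)
  have D: "(g has_derivative frechet_derivative f (at x)) (at x)" if "x \<in> S" for x
  proof (rule has_derivative_transform_within_open[OF _ assms(1) that])
    show "(f has_derivative frechet_derivative f (at x)) (at x)"
      using Suc.prems(2) that by (simp add: frechet_derivative_works)
  qed (use Suc.prems in auto)
  have "Ck_on k (partial_derivative b g) S" if b: "b \<in> Basis" for b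
  proof (rule Suc.IH)
    show "partial_derivative b f x = partial_derivative b g x" if "x \<in> S" for x
      using partial_derivative_eqI[OF D[OF that]] by (simp add: partial_derivative_def)
  qed (use Suc.prems b in auto)
  then show ?case using D by (auto simp: differentiable_def)
qed

text \<open>Replaces \<open>frechet_derivative\<close> by an explicit derivative \<open>D\<close>;
  the inductions on \<open>k\<close> below rest on it.\<close>

lemma Ck_on_SucI:
  assumes "open S" "\<And>x. x \<in> S \<Longrightarrow> (f has_derivative D x) (at x)"
    "\<And>b. b \<in> Basis \<Longrightarrow> Ck_on k (\<lambda>x. D x b) S"
  shows "Ck_on (Suc k) f S"
proof -
  have "Ck_on k (partial_derivative b f) S" if "b \<in> Basis" for b
    by (rule Ck_on_cong[OF assms(1) _ assms(3)[OF that]])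
      (simp add: partial_derivative_eqI[OF assms(2)])
  then show ?thesis using assms(2) by (auto simp: differentiable_def)
qed

lemma Ck_on_Suc_has_derivative:
  "Ck_on (Suc k) f S \<Longrightarrow> x \<in> S \<Longrightarrow> (f has_derivative frechet_derivative f (at x)) (at x)"
  by (simp add: frechet_derivative_works)

lemma Ck_on_Suc_partial:
  "Ck_on (Suc k) f S \<Longrightarrow> b \<in> Basis \<Longrightarrow> Ck_on k (\<lambda>x. frechet_derivative f (at x) b) S"
  by (simp add: partial_derivative_def[abs_def])

lemma Ck_on_Suc_imp: "Ck_on (Suc k) f S \<Longrightarrow> Ck_on k f S"
proof (induction k arbitrary: f)
  case 0
  then show ?case
    by (simp add: continuous_at_imp_continuous_on differentiable_imp_continuous_within)
next
  case (Suc k)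
  then have "\<forall>x\<in>S. f differentiable (at x)"
      "\<forall>b\<in>Basis. Ck_on (Suc k) (partial_derivative b f) S"
    unfolding Ck_on.simps(2)[of "Suc k" f S] by simp_all
  then show ?case
    unfolding Ck_on.simps(2)[of k f S] using Suc.IH by simp
qed

lemma Ck_on_subset: "Ck_on k f S \<Longrightarrow> T \<subseteq> S \<Longrightarrow> Ck_on k f T"
  by (induction k arbitrary: f) (auto intro: continuous_on_subset)

lemma Ck_on_const: "open S \<Longrightarrow> Ck_on k (\<lambda>x. c) S"
proof (induction k arbitrary: c)
  case (Suc k)
  show ?case by (rule Ck_on_SucI[where D = "\<lambda>x h. 0"]) (use Suc in auto)
qed auto

lemma Ck_on_id: "open S \<Longrightarrow> Ck_on k (\<lambda>x. x) S"
proof (induction k)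
  case (Suc k)
  show ?case
    by (rule Ck_on_SucI[where D = "\<lambda>x h. h"]) (use Suc in \<open>auto intro: Ck_on_const\<close>)
qed auto

lemma Ck_on_add:
  assumes "open S" "Ck_on k f S" "Ck_on k g S"
  shows "Ck_on k (\<lambda>x. f x + g x) S"
  using assms(2,3)
proof (induction k arbitrary: f g)
  case (Suc k)
  show ?case
    by (rule Ck_on_SucI[OF assms(1) has_derivative_add])
      (use Suc Ck_on_Suc_has_derivative Ck_on_Suc_partial in blast)+
qed (auto intro: continuous_intros)

lemma Ck_on_sum:
  assumes "open S" "\<And>i. i \<in> I \<Longrightarrow> Ck_on k (f i) S"
  shows "Ck_on k (\<lambda>x. \<Sum>i\<in>I. f i x) S"
  using assms(2)
  by (induction I rule: infinite_finite_induct) (auto intro!: Ck_on_const Ck_on_add assms(1))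

text \<open>Leibniz rule: both terms of the derivative are again of the form \<open>pr f g\<close>
  with factors of class C^k. Products, scalings and inner products are instances.\<close>

lemma Ck_on_bilinear:
  assumes "bounded_bilinear pr" "open S" "Ck_on k f S" "Ck_on k g S"
  shows "Ck_on k (\<lambda>x. pr (f x) (g x)) S"
  using assms(3,4)
proof (induction k arbitrary: f g)
  case 0
  then show ?case using bounded_bilinear.continuous_on[OF assms(1)] by auto
next
  case (Suc k)
  note D = Ck_on_Suc_has_derivative Ck_on_Suc_partial
  show ?case
  proof (rule Ck_on_SucI[OF assms(2) bounded_bilinear.FDERIV[OF assms(1)]])
    fix b :: 'd assume "b \<in> Basis"
    then show "Ck_on k (\<lambda>x. pr (f x) (frechet_derivative g (at x) b)
        + pr (frechet_derivative f (at x) b) (g x)) S"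
      by (intro Ck_on_add Suc.IH assms(2) Ck_on_Suc_imp[OF Suc.prems(1)]
          Ck_on_Suc_imp[OF Suc.prems(2)] D(2)[OF Suc.prems(1)] D(2)[OF Suc.prems(2)])
  qed (use Suc D in blast)+
qed

lemmas Ck_on_mult = Ck_on_bilinear[OF bounded_bilinear_mult]
  and Ck_on_scaleR = Ck_on_bilinear[OF bounded_bilinear_scaleR]
  and Ck_on_inner = Ck_on_bilinear[OF bounded_bilinear_inner]

text \<open>The chain rule is expanded over the basis: each term is a component of the derivative of
  \<open>f\<close> times a partial derivative of \<open>g\<close> composed with \<open>f\<close>.
  The induction hypothesis, stated for all \<open>g\<close>, covers the latter.\<close>

lemma Ck_on_compose:
  fixes f :: "'a::euclidean_space \<Rightarrow> 'b::euclidean_space" and g :: "'b \<Rightarrow> 'c::real_normed_vector"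
  assumes "open S" "f ` S \<subseteq> T" "Ck_on k f S" "Ck_on k g T"
  shows "Ck_on k (\<lambda>x. g (f x)) S"
  using assms(3,4)
proof (induction k arbitrary: g)
  case 0
  then show ?case using continuous_on_compose2 assms(2) by auto
next
  case (Suc k)
  let ?D = "\<lambda>x h. \<Sum>c\<in>Basis. (frechet_derivative f (at x) h \<bullet> c)
      *\<^sub>R frechet_derivative g (at (f x)) c"
  show ?case
  proof (rule Ck_on_SucI[OF assms(1), where D = ?D])
    fix x assume x: "x \<in> S"
    then have g: "(g has_derivative frechet_derivative g (at (f x))) (at (f x))"
      using assms(2) Suc.prems Ck_on_Suc_has_derivative by blast
    interpret G: bounded_linear "frechet_derivative g (at (f x))"
      using g by (rule has_derivative_bounded_linear)
    have "?D x = (\<lambda>h. frechet_derivative g (at (f x)) (frechet_derivative f (at x) h))"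
      by (rule ext) (simp add: G.scaleR[symmetric] G.sum[symmetric] euclidean_representation
          del: G.scaleR)
    then show "((\<lambda>x. g (f x)) has_derivative ?D x) (at x)"
      using has_derivative_compose[OF Ck_on_Suc_has_derivative[OF Suc.prems(1) x] g] by simp
  next
    fix b :: 'a assume b: "b \<in> Basis"
    then show "Ck_on k (\<lambda>x. ?D x b) S"
      by (intro Ck_on_sum Ck_on_scaleR Ck_on_inner Ck_on_const assms(1)
          Ck_on_Suc_partial[OF Suc.prems(1)]
          Suc.IH[where g = "\<lambda>y. frechet_derivative g (at y) _"] Ck_on_Suc_imp[OF Suc.prems(1)]
          Ck_on_Suc_partial[OF Suc.prems(2)])
  qed
qed

text \<open>The derivative is a polynomial in \<open>inverse\<close> itself, so the product rule
  closes the induction.\<close>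

lemma Ck_on_inverse: "Ck_on k (inverse :: real \<Rightarrow> real) (-{0})"
proof (induction k)
  case 0
  then show ?case by (auto intro!: continuous_intros)
next
  case (Suc k)
  show ?case
  proof (rule Ck_on_SucI[where D = "\<lambda>x h. - (inverse x * h * inverse x)"])
    fix b :: real
    have "Ck_on k (\<lambda>x. - b * (inverse x * inverse x)) (-{0})"
      by (intro Ck_on_mult Ck_on_const Suc open_delete) auto
    then show "Ck_on k (\<lambda>x. - (inverse x * b * inverse x)) (-{0})"
      by (simp add: mult_ac)
  qed (auto intro: has_derivative_inverse')
qed

lemma has_derivative_norm_at:
  fixes x :: "'a::euclidean_space"
  assumes "x \<noteq> 0"
  shows "(norm has_derivative (\<lambda>h. inverse (norm x) * (x \<bullet> h))) (at x)"
  using has_derivative_norm[OF assms] by (simp add: sgn_div_norm inner_commute divide_inverse)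

text \<open>The derivative at \<open>x\<close> in direction \<open>h\<close> involves only
  \<open>inverse (norm x)\<close> and \<open>x \<bullet> h\<close>, so the induction hypothesis for
  the norm, composed with \<open>inverse\<close>, suffices.\<close>

lemma Ck_on_norm: "Ck_on k (norm :: 'a::euclidean_space \<Rightarrow> real) (-{0})"
proof (induction k)
  case 0
  then show ?case by (auto intro!: continuous_intros)
next
  case (Suc k)
  show ?case
    by (rule Ck_on_SucI[OF _ has_derivative_norm_at])
      (auto intro!: Ck_on_mult Ck_on_inner Ck_on_const Ck_on_id
        Ck_on_compose[OF _ _ Suc Ck_on_inverse])
qed

section \<open>A smooth function vanishing on a half-line\<close>

text \<open>The case \<open>m = 0\<close> is the classical flat function exp(-1/t). The powers of
  1/t are included because the span of the family is then closed under differentiation.\<close>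

definition flat :: "nat \<Rightarrow> real \<Rightarrow> real"
  where "flat m t = (if 0 < t then inverse t ^ m * exp (- inverse t) else 0)"

text \<open>The term of degree \<open>m + 2\<close> of the exponential series bounds exp(1/t) from
  below. A bound quadratic in \<open>t\<close> is what forces the derivative at 0 to vanish.\<close>

lemma flat_le: "\<bar>flat m t\<bar> \<le> fact (m + 2) * t\<^sup>2"
proof (cases "0 < t")
  case True
  have "inverse t ^ (m + 2) / fact (m + 2) \<le> exp (inverse t)"
  proof -
    have "(\<Sum>i<m + 3. inverse t ^ i / fact i) \<le> exp (inverse t)"
      using Maclaurin_exp_le[of "inverse t" "m + 3"] True
      by (auto simp: add_increasing2 simp del: fact_Suc)
    moreover have "inverse t ^ (m + 2) / fact (m + 2) \<le> (\<Sum>i<m + 3. inverse t ^ i / fact i)"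
      using True by (intro member_le_sum[where f = "\<lambda>i. inverse t ^ i / fact i"]) auto
    ultimately show ?thesis by linarith
  qed
  then have "inverse t ^ (m + 2) / exp (inverse t) \<le> fact (m + 2)"
    by (simp only: pos_divide_le_eq[OF fact_gt_zero] pos_divide_le_eq[OF exp_gt_zero] mult.commute)
  then have "inverse t ^ (m + 2) * exp (- inverse t) \<le> fact (m + 2)"
    by (simp only: exp_minus divide_inverse)
  then have "inverse t ^ m * exp (- inverse t) \<le> fact (m + 2) * t\<^sup>2"
    using True by (simp add: field_simps power2_eq_square del: fact_Suc)
  then show ?thesis using True by (simp add: flat_def del: fact_Suc)
qed (simp add: flat_def)

lemma has_derivative_flat:
  "(flat m has_derivative (\<lambda>h. (flat (m + 2) t + - real m * flat (Suc m) t) * h)) (at t)"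
proof -
  consider "t < 0" | "t = 0" | "0 < t" by linarith
  then have "(flat m has_field_derivative (flat (m + 2) t + - real m * flat (Suc m) t)) (at t)"
  proof cases
    case 1
    have "((\<lambda>t. 0) has_field_derivative (flat (m + 2) t + - real m * flat (Suc m) t)) (at t)"
      using 1 by (simp add: flat_def)
    then show ?thesis
      by (rule has_field_derivative_transform_within_open[where S = "{..<0}"])
        (use 1 in \<open>auto simp: flat_def\<close>)
  next
    case 2
    have "((\<lambda>h. flat m h / h) \<longlongrightarrow> 0) (at 0)"
    proof (rule Lim_null_comparison)
      show "\<forall>\<^sub>F h in at 0. norm (flat m h / h) \<le> fact (m + 2) * \<bar>h\<bar>"
        using flat_le[of m]
        by (intro eventuallyI) (auto simp: abs_div divide_simps power2_eq_square abs_mult_self_eq mult.assoc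
            simp del: fact_Suc)
      show "((\<lambda>h::real. fact (m + 2) * \<bar>h\<bar>) \<longlongrightarrow> 0) (at 0)"
        by (intro tendsto_eq_intros) auto
    qed
    then show ?thesis using 2 by (simp add: DERIV_def flat_def[of _ 0])
  next
    case 3
    \<comment> \<open>For \<open>m = 0\<close> the exponent \<open>m - Suc 0\<close> truncates to 0,
      but the factor \<open>real m\<close> makes both sides zero.\<close>
    have "real m * inverse t ^ (m - Suc 0) * (inverse t * inverse t) = real m * inverse t ^ Suc m"
      by (cases m) (auto simp: mult_ac)
    then have "inverse t ^ m * (exp (- inverse t) * (inverse t * inverse t)) -
        real m * inverse t ^ (m - Suc 0) * (inverse t * inverse t) * exp (- inverse t)
        = flat (m + 2) t + - real m * flat (Suc m) t"
      using 3 by (simp only: flat_def) (simp add: mult_ac)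
    moreover have "((\<lambda>t. inverse t ^ m * exp (- inverse t)) has_field_derivative
        inverse t ^ m * (exp (- inverse t) * (inverse t * inverse t)) -
        real m * inverse t ^ (m - Suc 0) * (inverse t * inverse t) * exp (- inverse t)) (at t)"
      using 3 by (auto intro!: derivative_eq_intros simp: power2_eq_square)
    ultimately have "((\<lambda>t. inverse t ^ m * exp (- inverse t)) has_field_derivative
        (flat (m + 2) t + - real m * flat (Suc m) t)) (at t)"
      by (simp only:)
    then show ?thesis
      by (rule has_field_derivative_transform_within_open[where S = "{0<..}"])
        (use 3 in \<open>auto simp: flat_def\<close>)
  qed
  then show ?thesis by (simp only: has_field_derivative_def)
qed

lemma Ck_on_flat: "Ck_on k (flat m) UNIV"
proof (induction k arbitrary: m)
  case 0
  show ?case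
    using has_derivative_flat has_derivative_continuous
    by (metis Ck_on.simps(1) continuous_at_imp_continuous_on)
next
  case (Suc k)
  show ?case
    by (rule Ck_on_SucI[OF _ has_derivative_flat])
      (intro Ck_on_mult Ck_on_add Ck_on_const Suc open_UNIV)+
qed

section \<open>Transport of smooth boundaries by diffeomorphisms\<close>

lemma smooth_on_compose:
  fixes f :: "'a::euclidean_space \<Rightarrow> 'b::euclidean_space" and g :: "'b \<Rightarrow> 'c::real_normed_vector"
  assumes "open S" "f ` S \<subseteq> T" "smooth_on f S" "smooth_on g T"
  shows "smooth_on (g \<circ> f) S"
  using assms Ck_on_compose[of S f T _ g] by (auto simp: smooth_on_def o_def)

text \<open>Passes to abstract topologies, where homeomorphic maps are known to commute with
  frontier and closure.\<close>

lemma homeomorphic_map_euclidean: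
  assumes "homeomorphism UNIV UNIV f g"
  shows "homeomorphic_map euclidean euclidean f"
proof -
  have "homeomorphic_maps euclidean euclidean f g"
    using assms by (auto simp: homeomorphism_def homeomorphic_maps_def)
  then show ?thesis by (rule homeomorphic_maps_imp_map)
qed

lemma frontier_homeomorphism_image:
  assumes "homeomorphism UNIV UNIV f g"
  shows "frontier (f ` S) = f ` frontier S"
  using homeomorphic_map_frontier_of[OF homeomorphic_map_euclidean[OF assms], of S] by simp

lemma closure_homeomorphism_image:
  assumes "homeomorphism UNIV UNIV f g"
  shows "closure (f ` S) = f ` closure S"
  using homeomorphic_map_closure_of[OF homeomorphic_map_euclidean[OF assms], of S] by simp

text \<open>A chart \<open>\<phi>\<close> of \<open>S\<close> around \<open>g p\<close> becomes the
  chart \<open>\<phi> \<circ> g\<close> of the image around \<open>p\<close>, with inverse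
  \<open>f \<circ> \<psi>\<close>.\<close>

lemma smooth_boundary_image:
  fixes f g :: "'a::euclidean_space \<Rightarrow> 'a"
  assumes h: "homeomorphism UNIV UNIV f g" and "smooth_on g UNIV" "smooth_on f UNIV"
    and "smooth_boundary S"
  shows "smooth_boundary (f ` S)"
  unfolding smooth_boundary_def frontier_homeomorphism_image[OF h]
proof
  have fg: "f (g y) = y" "g (f x) = x" for x y
    using h by (auto simp: homeomorphism_def)
  fix p assume "p \<in> f ` frontier S"
  then have "g p \<in> frontier S" using fg by auto
  then obtain U V b and \<phi> \<psi> :: "'a \<Rightarrow> 'a" where *: "b \<in> Basis" "open U" "g p \<in> U" "open V"
      "homeomorphism U V \<phi> \<psi>" "smooth_on \<phi> U" "smooth_on \<psi> V"
      "\<phi> ` (U \<inter> S) = V \<inter> {y. 0 < y \<bullet> b}" "\<phi> ` (U \<inter> frontier S) = V \<inter> {y. y \<bullet> b = 0}"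
    using assms(4) unfolding smooth_boundary_def by meson
  have U: "f ` U = g -` U" using fg by (auto simp: image_iff) (metis fg)
  have "open (f ` U)"
    unfolding U using * h by (auto simp: homeomorphism_def intro: open_vimage)
  moreover have "p \<in> f ` U" using * U by simp
  moreover have gU: "homeomorphism (f ` U) U g f"
    by (rule homeomorphism_of_subsets[OF homeomorphism_symD[OF h]]) (auto simp: fg image_iff)
  then have "homeomorphism (f ` U) V (\<phi> \<circ> g) (f \<circ> \<psi>)"
    using *(5) by (rule homeomorphism_compose)
  moreover have "smooth_on (\<phi> \<circ> g) (f ` U)"
    using \<open>open (f ` U)\<close> *(6) assms(2) fg
    by (intro smooth_on_compose[where T = U]) (auto simp: smooth_on_def intro: Ck_on_subset)
  moreover have "smooth_on (f \<circ> \<psi>) V"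
    using * assms(3) by (intro smooth_on_compose[where T = UNIV]) auto
  moreover have "(\<phi> \<circ> g) ` (f ` U \<inter> f ` A) = \<phi> ` (U \<inter> A)" for A
  proof -
    have "inj f" by (metis fg(2) injI)
    then show ?thesis by (simp add: image_image fg flip: image_Int)
  qed
  then have "(\<phi> \<circ> g) ` (f ` U \<inter> f ` S) = V \<inter> {y. 0 < y \<bullet> b}"
      "(\<phi> \<circ> g) ` (f ` U \<inter> f ` frontier S) = V \<inter> {y. y \<bullet> b = 0}"
    by (simp_all only: *(8,9))
  ultimately show "\<exists>U V (\<phi> :: 'a \<Rightarrow> 'a) (\<psi> :: 'a \<Rightarrow> 'a). \<exists>b\<in>Basis. open U \<and> p \<in> U \<and> open V \<and>
      homeomorphism U V \<phi> \<psi> \<and> smooth_on \<phi> U \<and> smooth_on \<psi> V \<and>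
      \<phi> ` (U \<inter> f ` S) = V \<inter> {y. 0 < y \<bullet> b} \<and>
      \<phi> ` (U \<inter> f ` frontier S) = V \<inter> {y. y \<bullet> b = 0}"
    by - (rule exI[of _ "f ` U"], rule exI[of _ V], rule exI[of _ "\<phi> \<circ> g"],
        rule exI[of _ "f \<circ> \<psi>"], rule bexI[OF _ *(1)], intro conjI *(4))
qed

section \<open>Smoothness of the unit sphere as a boundary\<close>

text \<open>Inversion about the point \<open>-b\<close> with radius \<open>sqrt 2\<close>: for a unit vector \<open>b\<close> it maps the unit
  ball onto a half-space, so it serves as a boundary chart off the pole.\<close>

definition inversion :: "'a::euclidean_space \<Rightarrow> 'a \<Rightarrow> 'a"
  where "inversion b y = (2 * inverse ((y + b) \<bullet> (y + b))) *\<^sub>R (y + b) + - b"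

lemma inversion_ne:
  assumes "y \<noteq> - b"
  shows "inversion b y \<noteq> - b"
proof -
  have "y + b \<noteq> 0" using assms by (simp add: add_eq_0_iff2)
  then have "(2 * inverse ((y + b) \<bullet> (y + b))) *\<^sub>R (y + b) \<noteq> 0" by simp
  then show ?thesis unfolding inversion_def by (simp only: add_right_cancel[of _ "- b" 0, simplified add_0_left] not_False_eq_True)
qed

text \<open>In the coordinate \<open>w = y + b\<close> the map is w -> 2 w / |w|^2, which is an
  involution.\<close>

lemma inversion_inversion:
  assumes "y \<noteq> - b"
  shows "inversion b (inversion b y) = y"
proof -
  define w where "w = y + b"
  have "w \<bullet> w \<noteq> 0" using assms by (simp add: w_def add_eq_0_iff2)
  moreover have "inversion b y + b = (2 * inverse (w \<bullet> w)) *\<^sub>R w"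
    by (simp add: inversion_def w_def)
  ultimately have "inversion b (inversion b y) = w + - b"
    unfolding inversion_def[of b "inversion b y"] by (simp add: field_simps del: inner_eq_zero_iff)
  then show ?thesis by (simp add: w_def)
qed

text \<open>The last factor is positive, so the height of the image over the hyperplane orthogonal
  to \<open>b\<close> has the sign of 1 - |y|^2.\<close>

lemma inversion_inner:
  assumes "norm b = 1" "y \<noteq> - b"
  shows "inversion b y \<bullet> b = (1 - y \<bullet> y) * inverse ((y + b) \<bullet> (y + b))"
proof -
  have b: "b \<bullet> b = 1" using assms by (simp add: norm_eq_1)
  define w where "w = y + b"
  have "w \<bullet> w \<noteq> 0" using assms by (simp add: w_def add_eq_0_iff2)
  then have "inversion b y \<bullet> b = (2 * (w \<bullet> b) - w \<bullet> w) * inverse (w \<bullet> w)"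
    unfolding inversion_def w_def[symmetric]
    by (simp add: inner_diff_left b field_simps del: inner_eq_zero_iff)
  also have "2 * (w \<bullet> b) - w \<bullet> w = 1 - y \<bullet> y"
    by (simp add: w_def inner_simps b inner_commute)
  finally show ?thesis by (simp add: w_def)
qed

lemma smooth_on_inversion: "smooth_on (inversion b) (-{-b})"
proof -
  have o: "open (-{-b})" by auto
  have "Ck_on k (inversion b) (-{-b})" for k
    unfolding inversion_def[abs_def]
    by (intro Ck_on_add Ck_on_scaleR Ck_on_mult Ck_on_const Ck_on_id o Ck_on_inner
        Ck_on_compose[OF o _ _ Ck_on_inverse]) (auto simp: add_eq_0_iff2)
  then show ?thesis by (simp add: smooth_on_def)
qed

lemma two_Basis_elements:
  assumes "2 \<le> DIM('a::euclidean_space)"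
  obtains b c :: "'a::euclidean_space" where "b \<in> Basis" "c \<in> Basis" "b \<noteq> c"
proof -
  have "\<not> card (Basis :: 'a set) \<le> Suc 0" using assms by simp
  then show ?thesis using card_le_Suc0_iff_eq[OF finite_Basis] that by blast
qed

lemma smooth_boundary_ball:
  assumes "2 \<le> DIM('a::euclidean_space)"
  shows "smooth_boundary (ball 0 1 :: 'a set)"
  unfolding smooth_boundary_def frontier_ball[OF zero_less_one]
proof
  fix p :: 'a assume "p \<in> sphere 0 1"
  \<comment> \<open>The pole \<open>- b\<close> of the chart must differ from \<open>p\<close>. Of
    two distinct basis vectors at most one equals \<open>- p\<close>; this is where dimension at
    least 2 enters.\<close>
  obtain b :: 'a where b: "b \<in> Basis" "p \<noteq> - b"
  proof -
    obtain b c :: 'a where "b \<in> Basis" "c \<in> Basis" "b \<noteq> c"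
      using two_Basis_elements[OF assms] .
    then show ?thesis using that[of b] that[of c] by (cases "p = - b") auto
  qed
  then have n: "norm b = 1" by simp
  let ?U = "-{-b}" and ?J = "inversion b"
  have sub: "?J ` ?U \<subseteq> ?U" using inversion_ne[of _ b] by (metis ComplD ComplI image_subsetI singletonD singletonI)
  have c: "continuous_on ?U ?J"
    using smooth_on_inversion[of b] by (metis Ck_on.simps(1) smooth_on_def)
  have hom: "homeomorphism ?U ?U ?J ?J"
    by (rule homeomorphismI[OF c c sub sub]) (auto simp: inversion_inversion)
  have ball: "y \<in> ball 0 1 \<longleftrightarrow> 0 < ?J y \<bullet> b" and sphere: "y \<in> sphere 0 1 \<longleftrightarrow> ?J y \<bullet> b = 0"
    if "y \<noteq> - b" for y
  proof -
    define k where "k = inverse ((y + b) \<bullet> (y + b))"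
    have "0 < k" using that by (simp add: k_def add_eq_0_iff2)
    moreover have "?J y \<bullet> b = (1 - y \<bullet> y) * k" by (simp only: inversion_inner[OF n that] k_def)
    ultimately show "y \<in> ball 0 1 \<longleftrightarrow> 0 < ?J y \<bullet> b" "y \<in> sphere 0 1 \<longleftrightarrow> ?J y \<bullet> b = 0"
      by (auto simp: zero_less_mult_iff norm_eq_1 norm_lt_square)
  qed
  \<comment> \<open>\<open>?J\<close> is a bijection of \<open>?U\<close>, so conditions on
    \<open>?J y\<close> turn into descriptions of images.\<close>
  have im: "?J ` (?U \<inter> {y. P (?J y)}) = ?U \<inter> {y. P y}" for P
    using homeomorphism_image1[OF hom] by auto
  have "?U \<inter> ball 0 1 = ?U \<inter> {y. 0 < ?J y \<bullet> b}" "?U \<inter> sphere 0 1 = ?U \<inter> {y. ?J y \<bullet> b = 0}"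
    using ball sphere by auto
  then have "?J ` (?U \<inter> ball 0 1) = ?U \<inter> {y. 0 < y \<bullet> b}"
      "?J ` (?U \<inter> sphere 0 1) = ?U \<inter> {y. y \<bullet> b = 0}"
    using im[of "\<lambda>y. 0 < y \<bullet> b"] im[of "\<lambda>y. y \<bullet> b = 0"] by simp_all
  moreover have "open ?U" "p \<in> ?U" using b by auto
  ultimately show "\<exists>U V (\<phi> :: 'a \<Rightarrow> 'a) (\<psi> :: 'a \<Rightarrow> 'a). \<exists>b\<in>Basis. open U \<and> p \<in> U \<and> open V \<and>
      homeomorphism U V \<phi> \<psi> \<and> smooth_on \<phi> U \<and> smooth_on \<psi> V \<and>
      \<phi> ` (U \<inter> ball 0 1) = V \<inter> {y. 0 < y \<bullet> b} \<and>
      \<phi> ` (U \<inter> sphere 0 1) = V \<inter> {y. y \<bullet> b = 0}"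
    by - (rule exI[of _ ?U], rule exI[of _ ?U], rule exI[of _ ?J], rule exI[of _ ?J],
        rule bexI[OF _ b(1)], intro conjI hom smooth_on_inversion)
qed

section \<open>The shear and its profile\<close>

definition shear :: "(real \<Rightarrow> real) \<Rightarrow> 'a::euclidean_space \<Rightarrow> 'a \<Rightarrow> 'a \<Rightarrow> 'a"
  where "shear g e d x = x + g (x \<bullet> e) *\<^sub>R d"

lemma smooth_on_shear:
  assumes "smooth_on g UNIV"
  shows "smooth_on (shear g e d) UNIV"
proof -
  have "Ck_on k (shear g e d) UNIV" for k
  proof -
    have g: "Ck_on k g UNIV" using assms by (simp add: smooth_on_def)
    show ?thesis
      unfolding shear_def[abs_def]
      by (intro Ck_on_add Ck_on_scaleR Ck_on_const Ck_on_id open_UNIV Ck_on_inner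
          Ck_on_compose[OF open_UNIV subset_UNIV _ g])
  qed
  then show ?thesis by (simp add: smooth_on_def)
qed

text \<open>As \<open>d\<close> is orthogonal to \<open>e\<close>, the height
  \<open>x \<bullet> e\<close> is preserved, so shearing by \<open>- g\<close> undoes shearing by
  \<open>g\<close>.\<close>

lemma homeomorphism_shear:
  assumes "continuous_on UNIV g" "d \<bullet> e = 0"
  shows "homeomorphism UNIV UNIV (shear g e d) (shear (\<lambda>t. - g t) e d)"
proof -
  have "continuous_on UNIV (shear h e d)" if "continuous_on UNIV h" for h
    unfolding shear_def[abs_def]
    by (intro continuous_intros continuous_on_compose2[OF that]) auto
  from this[OF assms(1)] this[OF continuous_on_minus[OF assms(1)]] show ?thesis
    by (rule homeomorphismI) (auto simp: shear_def inner_add_left inner_diff_left assms(2))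
qed

text \<open>The factor \<open>2 * exp 2\<close> normalises the value at 0 to 2, since
  \<open>flat 0 (1 / 2)\<close> is exp(-2). The argument is written as a sum with
  \<open>- 1 * t\<close> to match \<open>Ck_on_add\<close> and \<open>Ck_on_mult\<close>.\<close>

definition lift_height :: "real \<Rightarrow> real"
  where "lift_height t = 2 * exp 2 * flat 0 (1 / 2 + - 1 * t)"

text \<open>These heights serve in turn to keep the cap, to exclude the origin and to refute
  convexity.\<close>

lemma lift_height_values: "1 / 2 \<le> t \<Longrightarrow> lift_height t = 0" "lift_height 0 = 2" "lift_height (- (1 / 2)) = 2 * exp 1"
  by (auto simp: lift_height_def flat_def simp flip: exp_add)

lemma smooth_on_lift_height: "smooth_on lift_height UNIV" "smooth_on (\<lambda>t. - 1 * lift_height t) UNIV"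
proof -
  have *: "Ck_on k lift_height UNIV" for k
    unfolding lift_height_def[abs_def]
    by (intro Ck_on_mult Ck_on_add Ck_on_const Ck_on_id open_UNIV
        Ck_on_compose[OF open_UNIV subset_UNIV _ Ck_on_flat])
  then show "smooth_on lift_height UNIV" by (simp add: smooth_on_def)
  have "Ck_on k (\<lambda>t. - 1 * lift_height t) UNIV" for k
    by (intro Ck_on_mult Ck_on_const open_UNIV *)
  then show "smooth_on (\<lambda>t. - 1 * lift_height t) UNIV" by (simp add: smooth_on_def)
qed

text \<open>The cap is the radial projection of the convex cone \<open>?C\<close>. The strict
  inequality keeps 0 out of the cone, so the projection is continuous there.\<close>

lemma connected_spherical_cap: "connected {x \<in> sphere 0 1. 1 / 2 < x \<bullet> e}"
proof -
  let ?C = "{y. norm y < 2 * (y \<bullet> e)}"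
  have "convex ?C"
  proof (rule convexI)
    fix x y :: 'a and u v :: real
    assume *: "x \<in> ?C" "y \<in> ?C" "0 \<le> u" "0 \<le> v" "u + v = 1"
    have "norm (u *\<^sub>R x + v *\<^sub>R y) \<le> u * norm x + v * norm y"
      using norm_triangle_ineq[of "u *\<^sub>R x" "v *\<^sub>R y"] * by simp
    also have "\<dots> < u * (2 * (x \<bullet> e)) + v * (2 * (y \<bullet> e))"
      using * by (cases "u = 0") (auto intro!: add_less_le_mono mult_left_mono)
    finally show "u *\<^sub>R x + v *\<^sub>R y \<in> ?C" by (simp add: inner_simps algebra_simps)
  qed
  then have "connected ((\<lambda>y. y /\<^sub>R norm y) ` ?C)"
    by (intro connected_continuous_image convex_connected continuous_intros) auto
  moreover have "(\<lambda>y. y /\<^sub>R norm y) ` ?C = {x \<in> sphere 0 1. 1 / 2 < x \<bullet> e}"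
  proof (intro equalityI subsetI)
    fix x assume "x \<in> (\<lambda>y. y /\<^sub>R norm y) ` ?C"
    then obtain y where "x = y /\<^sub>R norm y" "norm y < 2 * (y \<bullet> e)" by auto
    moreover from this have "0 < norm y" by auto
    ultimately show "x \<in> {x \<in> sphere 0 1. 1 / 2 < x \<bullet> e}" by (simp add: field_simps)
  next
    fix x assume "x \<in> {x \<in> sphere 0 1. 1 / 2 < x \<bullet> e}"
    then show "x \<in> (\<lambda>y. y /\<^sub>R norm y) ` ?C" by (intro image_eqI[of _ _ x]) auto
  qed
  ultimately show ?thesis by simp
qed

section \<open>The conical solution\<close>

text \<open>When \<open>u\<close> is C^2 on a neighbourhood of the closure, its own derivatives
  serve as the continuous extensions.\<close>

lemma C2_closureI:
  assumes "open T" "closure S \<subseteq> T" "Ck_on 2 u T"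
  shows "C2_closure u S"
proof -
  have 2: "Ck_on (Suc (Suc 0)) u T" using assms(3) by (simp only: numeral_2_eq_2)
  have "extends_to_closure v S" if "continuous_on T v" for v :: "'a \<Rightarrow> real"
    using that continuous_on_subset[OF that assms(2)] by (auto simp: extends_to_closure_def)
  moreover have "Ck_on 2 u S"
    using assms closure_subset by (blast intro: Ck_on_subset)
  moreover have "Ck_on 0 u T" using 2 Ck_on_Suc_imp by blast
  then have "continuous_on (closure S) u" using assms(2) continuous_on_subset by auto
  moreover have "continuous_on T (partial_derivative b u)"
      "continuous_on T (partial_derivative c (partial_derivative b u))"
    if "b \<in> Basis" "c \<in> Basis" for b c
    using 2 that Ck_on_Suc_imp[of 0 "partial_derivative b u" T] by (metis Ck_on.simps)+
  ultimately show ?thesis unfolding C2_closure_def by blast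
qed

text \<open>This is 8 (1 - |x|), expanded so that \<open>Ck_on_add\<close> and
  \<open>Ck_on_mult\<close> apply directly.\<close>

definition conical :: "'a::euclidean_space \<Rightarrow> real"
  where "conical x = 8 + - 8 * norm x"

lemma Ck_on_conical: "Ck_on k (conical :: 'a::euclidean_space \<Rightarrow> real) (-{0})"
  unfolding conical_def[abs_def]
  by (intro Ck_on_add Ck_on_mult Ck_on_const Ck_on_norm open_delete) auto

lemma partial_derivative_conical:
  assumes "x \<noteq> 0"
  shows "partial_derivative b conical x = - 8 * (inverse (norm x) * (x \<bullet> b))"
proof -
  have "(conical has_derivative (\<lambda>h. - 8 * (inverse (norm x) * (x \<bullet> h)))) (at x)"
    using has_derivative_add[OF has_derivative_const
        has_derivative_mult_right[OF has_derivative_norm_at[OF assms]], of 8 "- 8"]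
    by (simp add: conical_def[abs_def])
  then show ?thesis by (rule partial_derivative_eqI)
qed

lemma gradient_conical:
  assumes "x \<noteq> 0"
  shows "gradient conical x = (- 8 * inverse (norm x)) *\<^sub>R x"
proof -
  have "gradient conical x = (- 8 * inverse (norm x)) *\<^sub>R (\<Sum>b\<in>Basis. (x \<bullet> b) *\<^sub>R b)"
    unfolding gradient_def scaleR_sum_right
    by (rule sum.cong) (simp_all add: partial_derivative_conical[OF assms])
  then show ?thesis by (simp add: euclidean_representation)
qed

text \<open>Summed over the basis, the squared coordinates give |x|^2, so the bracket adds up to
  n/|x| - 1/|x|.\<close>

lemma laplacian_conical:
  fixes x :: "'a::euclidean_space"
  assumes "x \<noteq> 0"
  shows "laplacian conical x = - 8 * (real DIM('a) - 1) / norm x"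
proof -
  have "partial_derivative b (partial_derivative b conical) x
      = - 8 * (inverse (norm x) - inverse (norm x) ^ 3 * ((x \<bullet> b) * (x \<bullet> b)))"
    if "b \<in> Basis" for b
  proof -
    have "((\<lambda>x. - 8 * (inverse (norm x) * (x \<bullet> b))) has_derivative
        (\<lambda>h. - 8 * (inverse (norm x) * (h \<bullet> b)
          - inverse (norm x) ^ 3 * ((x \<bullet> h) * (x \<bullet> b))))) (at x)"
    proof (rule has_derivative_eq_rhs)
      show "((\<lambda>x. - 8 * (inverse (norm x) * (x \<bullet> b))) has_derivative
          (\<lambda>h. - 8 * (inverse (norm x) * (h \<bullet> b) +
            - (inverse (norm x) * (inverse (norm x) * (x \<bullet> h)) * inverse (norm x)) * (x \<bullet> b)))) (at x)"
        by (rule has_derivative_mult_right[OF has_derivative_mult[OF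
              Deriv.has_derivative_inverse[OF _ has_derivative_norm_at[OF assms]]
              has_derivative_inner_left[OF has_derivative_ident]]]) (use assms in simp)
    qed (simp add: power3_eq_cube algebra_simps)
    \<comment> \<open>The formula for the first partial derivative holds off the origin, an open
      set, and can therefore be differentiated at \<open>x\<close>.\<close>
    then have "(partial_derivative b conical has_derivative
        (\<lambda>h. - 8 * (inverse (norm x) * (h \<bullet> b)
          - inverse (norm x) ^ 3 * ((x \<bullet> h) * (x \<bullet> b))))) (at x)"
      by (rule has_derivative_transform_within_open[where s = "-{0}"])
        (use assms in \<open>auto simp: partial_derivative_conical\<close>)
    from partial_derivative_eqI[OF this, of b] show ?thesis using that by simp
  qed
  then have "laplacian conical x = (\<Sum>b\<in>Basis.
      - 8 * (inverse (norm x) - inverse (norm x) ^ 3 * ((x \<bullet> b) * (x \<bullet> b))))"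
    unfolding laplacian_def by (intro sum.cong) auto
  also have "\<dots> = - 8 * (real DIM('a) * inverse (norm x)
      - inverse (norm x) ^ 3 * (\<Sum>b\<in>Basis. (x \<bullet> b) * (x \<bullet> b)))"
    by (simp add: sum_distrib_left[symmetric] sum_subtractf)
  also have "(\<Sum>b\<in>Basis. (x \<bullet> b) * (x \<bullet> b)) = norm x * norm x"
    by (simp only: euclidean_inner[symmetric] dot_square_norm power2_eq_square)
  finally show ?thesis using assms by (simp add: field_simps power3_eq_cube)
qed

lemma boundary_gradientI:
  assumes "open T" "open S" "x \<in> frontier S" "x \<in> T" "continuous_on T (gradient u)"
  shows "boundary_gradient u S x = gradient u x"
proof -
  have "(gradient u \<longlongrightarrow> gradient u x) (at x within S)"
    using assms by (metis at_within_open continuous_on_def tendsto_within_subset top_greatest)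
  \<comment> \<open>An open set is disjoint from its frontier, so \<open>x\<close> is approached by
    other points of \<open>S\<close> and the value of \<open>Lim\<close> is unique.\<close>
  moreover have "x islimpt S"
    using assms by (auto simp: frontier_def closure_def interior_open)
  ultimately show ?thesis
    unfolding boundary_gradient_def by (intro tendsto_Lim) (auto simp: trivial_limit_within)
qed

section \<open>The nonlinearity\<close>

text \<open>The function m / (8 - s), cut off at the level \<open>s = 8 - \<delta>\<close> before
  its pole at 8. The second summand vanishes up to that level and grows beyond it, where the first
  one is constant.\<close>

definition nonlinearity :: "real \<Rightarrow> real \<Rightarrow> real \<Rightarrow> real"
  where "nonlinearity m \<delta> s = m / max \<delta> (8 - s) + max 0 (s - 8 + \<delta>)"

context
  fixes m \<delta> :: real
  assumes pos: "0 < m" "0 < \<delta>"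
begin

lemma nonlinearity_pos: "0 < nonlinearity m \<delta> s"
  using pos by (simp add: nonlinearity_def add_pos_nonneg)

lemma strict_mono_nonlinearity: "strict_mono (nonlinearity m \<delta>)"
proof (rule strict_monoI)
  fix s t :: real assume "s < t"
  show "nonlinearity m \<delta> s < nonlinearity m \<delta> t"
  proof (cases "8 - s \<le> \<delta>")
    case True
    then show ?thesis using \<open>s < t\<close> by (simp add: nonlinearity_def max_def)
  next
    case False
    then have "m / max \<delta> (8 - s) < m / max \<delta> (8 - t)"
      using \<open>s < t\<close> pos by (intro divide_strict_left_mono) auto
    moreover have "max 0 (s - 8 + \<delta>) \<le> max 0 (t - 8 + \<delta>)" using \<open>s < t\<close> by auto
    ultimately show ?thesis unfolding nonlinearity_def by linarith
  qed
qed

text \<open>Both denominators are at least \<open>\<delta>\<close>, so m/a - m/b = m (b - a) / (a b)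
  yields the constant \<open>m / \<delta>\<^sup>2\<close>; the second summand is
  1-Lipschitz.\<close>

lemma lipschitz_nonlinearity: "(m / \<delta>\<^sup>2 + 1)-lipschitz_on UNIV (nonlinearity m \<delta>)"
proof (rule lipschitz_onI)
  fix s t :: real
  define a b where "a = max \<delta> (8 - s)" and "b = max \<delta> (8 - t)"
  have ab: "\<delta> \<le> a" "\<delta> \<le> b" "\<bar>b - a\<bar> \<le> \<bar>s - t\<bar>" by (auto simp: a_def b_def)
  then have "m / a - m / b = m * (b - a) / (a * b)"
    using pos by (simp add: field_simps)
  then have "\<bar>m / a - m / b\<bar> = m * \<bar>b - a\<bar> / (a * b)"
    using ab pos by (simp add: abs_mult)
  also have "\<dots> \<le> m * \<bar>s - t\<bar> / (\<delta> * \<delta>)"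
    using ab pos by (intro frac_le mult_mono mult_left_mono mult_pos_pos) auto
  finally have "\<bar>m / a - m / b\<bar> \<le> m / \<delta>\<^sup>2 * \<bar>s - t\<bar>" by (simp add: power2_eq_square)
  moreover define p q where "p = max 0 (s - 8 + \<delta>)" and "q = max 0 (t - 8 + \<delta>)"
  then have "\<bar>p - q\<bar> \<le> \<bar>s - t\<bar>" by auto
  ultimately have "\<bar>m / a - m / b\<bar> + \<bar>p - q\<bar> \<le> m / \<delta>\<^sup>2 * \<bar>s - t\<bar> + 1 * \<bar>s - t\<bar>"
    by (intro add_mono) simp_all
  moreover have "\<bar>m / a + p - (m / b + q)\<bar> \<le> \<bar>m / a - m / b\<bar> + \<bar>p - q\<bar>" by linarith
  ultimately show "dist (nonlinearity m \<delta> s) (nonlinearity m \<delta> t) \<le> (m / \<delta>\<^sup>2 + 1) * dist s t"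
    unfolding nonlinearity_def dist_real_def a_def[symmetric] b_def[symmetric] p_def[symmetric]
      q_def[symmetric] distrib_right
    by (rule order_trans[rotated])
qed (use pos in simp)

end

section \<open>Construction of the domain and conclusion\<close>

text \<open>Failure of convexity is what rules out balls. The last equation identifies the whole
  boundary above height 1/2, so the cap is relatively open.\<close>

lemma exists_smooth_domain:
  assumes "2 \<le> DIM('a::euclidean_space)"
  obtains \<Omega> :: "'a::euclidean_space set" and e :: 'a
  where "open \<Omega>" "bounded \<Omega>" "\<Omega> \<noteq> {}" "simply_connected \<Omega>" "\<not> convex \<Omega>"
    "smooth_boundary \<Omega>" "0 \<notin> closure \<Omega>" "e \<in> Basis"
    "frontier \<Omega> \<inter> {x. 1 / 2 < x \<bullet> e} = {x \<in> sphere 0 1. 1 / 2 < x \<bullet> e}"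
proof -
  obtain e d :: 'a where ed: "e \<in> Basis" "d \<in> Basis" "e \<noteq> d"
    using two_Basis_elements[OF assms] .
  then have in_ed: "e \<bullet> e = 1" "d \<bullet> d = 1" "e \<bullet> d = 0" "d \<bullet> e = 0"
    by (auto simp: inner_Basis)
  let ?f = "shear lift_height e d" and ?g = "shear (\<lambda>t. - lift_height t) e d"
  have cont: "continuous_on UNIV lift_height"
    using smooth_on_lift_height(1) by (metis Ck_on.simps(1) smooth_on_def)
  have hom: "homeomorphism UNIV UNIV ?f ?g"
    by (rule homeomorphism_shear[OF cont in_ed(4)])
  then have inv: "?f (?g x) = x" "?g (?f x) = x" for x
    by (auto simp: homeomorphism_def)
  \<comment> \<open>Membership in a sheared set is tested by evaluating the explicit inverse shear
    \<open>?g\<close>.\<close>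
  have image: "?f ` S = {x. ?g x \<in> S}" for S
    using inv by (auto simp: image_iff) (metis inv(1))
  let ?\<Omega> = "?f ` ball 0 1"
  have compact: "compact (?f ` cball 0 1)"
    using hom by (intro compact_continuous_image) (auto simp: homeomorphism_def intro: continuous_on_subset)
  have "open ?\<Omega>"
  proof -
    have "?\<Omega> = ?g -` ball 0 1" by (simp only: image vimage_def)
    then show ?thesis using hom by (simp add: homeomorphism_def open_vimage)
  qed
  moreover have "bounded ?\<Omega>"
    by (rule bounded_subset[OF compact_imp_bounded[OF compact]]) auto
  moreover have "?\<Omega> \<noteq> {}" by simp
  moreover have "simply_connected ?\<Omega>"
  proof -
    have "homeomorphism (ball 0 1) ?\<Omega> ?f ?g"
      by (rule homeomorphism_of_subsets[OF hom]) (auto simp: inv image_iff)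
    then have "(ball 0 1 :: 'a set) homeomorphic ?\<Omega>" by (auto simp: homeomorphic_def)
    then show ?thesis
      using homeomorphic_simply_connected_eq convex_imp_simply_connected convex_ball by blast
  qed
  moreover have "smooth_boundary ?\<Omega>"
    using smooth_on_lift_height by (intro smooth_boundary_image[OF hom] smooth_on_shear
        smooth_boundary_ball assms) simp_all
  \<comment> \<open>The inverse shear sends 0 to -2 d, which lies outside the closed unit
    ball.\<close>
  moreover have "0 \<notin> closure ?\<Omega>"
    unfolding closure_homeomorphism_image[OF hom] closure_ball[OF zero_less_one]
    unfolding image
    using ed by (simp add: shear_def lift_height_values)
  \<comment> \<open>Above height 1/2 the profile is zero and the shear is the identity.\<close>
  moreover have "frontier ?\<Omega> \<inter> {x. 1 / 2 < x \<bullet> e} = {x \<in> sphere 0 1. 1 / 2 < x \<bullet> e}"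
    unfolding frontier_homeomorphism_image[OF hom] frontier_ball[OF zero_less_one]
    unfolding image
    by (auto simp: shear_def lift_height_values)
  moreover have "\<not> convex ?\<Omega>"
  proof
    \<comment> \<open>The points of the ball at heights 1/2 and -1/2 with \<open>d\<close>-component
      4/5 have squared norm 89/100. They are lifted by 0 and \<open>2 * exp 1\<close>, so the
      midpoint of their images has height 0 and \<open>d\<close>-component
      \<open>exp 1 + 4 / 5\<close>. There the lift is only 2, and the preimage has norm above
      1.\<close>
    let ?p = "(1 / 2) *\<^sub>R e + (4 / 5) *\<^sub>R d"
      and ?q = "(- 1 / 2) *\<^sub>R e + (2 * exp 1 + 4 / 5) *\<^sub>R d"
    have "?g ?p = (1 / 2) *\<^sub>R e + (4 / 5) *\<^sub>R d" "?g ?q = (- 1 / 2) *\<^sub>R e + (4 / 5) *\<^sub>R d"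
      by (simp_all add: shear_def inner_simps in_ed lift_height_values algebra_simps)
    then have pq: "?p \<in> ?\<Omega>" "?q \<in> ?\<Omega>"
      unfolding image by (simp_all add: norm_lt_square inner_simps in_ed power2_eq_square)
    assume "convex ?\<Omega>"
    then have "(1 / 2) *\<^sub>R ?p + (1 / 2) *\<^sub>R ?q \<in> ?\<Omega>"
      by (rule convexD[OF _ pq]) simp_all
    moreover have "(1 / 2) *\<^sub>R ?p + (1 / 2) *\<^sub>R ?q = (exp 1 + 4 / 5) *\<^sub>R d"
      by (simp add: algebra_simps flip: scaleR_add_left)
    moreover have "?g ((exp 1 + 4 / 5) *\<^sub>R d) = (exp 1 - 6 / 5) *\<^sub>R d"
      by (simp add: shear_def in_ed lift_height_values algebra_simps flip: scaleR_add_left)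
    ultimately have "\<bar>exp 1 - 6 / 5 :: real\<bar> < 1"
      unfolding image using ed by simp
    \<comment> \<open>The quadratic Taylor bound gives exp 1 \<ge> 5/2, hence exp 1 - 6/5 \<ge>
      13/10.\<close>
    then show False using exp_lower_Taylor_quadratic[of 1] by simp
  qed
  ultimately show ?thesis using that ed(1) by blast
qed

theorem theorem3p1:
  assumes "2 \<le> CARD('n::finite)"
  shows "\<exists>(f :: real \<Rightarrow> real) (\<Omega> :: (real ^ 'n) set) (\<Gamma> :: (real ^ 'n) set) (u :: real ^ 'n \<Rightarrow> real).
    (\<exists>L. L-lipschitz_on UNIV f) \<and> strict_mono f \<and> (\<forall>s. 0 < f s) \<and>
    open \<Omega> \<and> bounded \<Omega> \<and> \<Omega> \<noteq> {} \<and> simply_connected \<Omega> \<and> (\<forall>c r. \<Omega> \<noteq> ball c r) \<and>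
    smooth_boundary \<Omega> \<and>
    \<Gamma> \<subseteq> frontier \<Omega> \<and> \<Gamma> \<noteq> {} \<and> connected \<Gamma> \<and> openin (top_of_set (frontier \<Omega>)) \<Gamma> \<and>
    (\<exists>c r. 0 < r \<and> \<Gamma> \<subseteq> sphere c r) \<and>
    C2_closure u \<Omega> \<and>
    (\<forall>x\<in>\<Omega>. - laplacian u x = f (u x)) \<and>
    (\<forall>x\<in>frontier \<Omega>. norm (boundary_gradient u \<Omega> x) = 8) \<and>
    (\<forall>x\<in>\<Gamma>. u x = 0)"
proof -
  have dim: "2 \<le> DIM(real ^ 'n)" using assms by simp
  obtain \<Omega> :: "(real ^ 'n) set" and e :: "real ^ 'n" where \<Omega>: "open \<Omega>" "bounded \<Omega>" "\<Omega> \<noteq> {}"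
      "simply_connected \<Omega>" "\<not> convex \<Omega>" "smooth_boundary \<Omega>" "0 \<notin> closure \<Omega>" "e \<in> Basis"
      "frontier \<Omega> \<inter> {x. 1 / 2 < x \<bullet> e} = {x \<in> sphere 0 1. 1 / 2 < x \<bullet> e}"
    using exists_smooth_domain[OF dim] by blast
  obtain \<delta> where \<delta>: "0 < \<delta>" "\<And>x. x \<in> closure \<Omega> \<Longrightarrow> \<delta> \<le> norm x"
    using separate_point_closed[OF closed_closure \<Omega>(7)] by auto
  define \<Gamma> where "\<Gamma> = {x \<in> sphere 0 1. 1 / 2 < x \<bullet> e}"
  \<comment> \<open>With \<open>s = conical x\<close> one has 8 - s = 8 |x|, so 8 (n - 1) / |x|
    equals 64 (n - 1) / (8 - s).\<close>
  define m where "m = 64 * (real DIM(real ^ 'n) - 1)"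
  have pos: "0 < m" "0 < 8 * \<delta>" using dim \<delta> by (auto simp: m_def)
  \<comment> \<open>On the closure 8 - u = 8 |x| is at least \<open>8 * \<delta>\<close>, so the
    cut-off leaves the equation unchanged there.\<close>
  let ?f = "nonlinearity m (8 * \<delta>)"
  have "\<exists>L. L-lipschitz_on UNIV ?f" using lipschitz_nonlinearity[OF pos] by blast
  moreover note strict_mono_nonlinearity[OF pos]
  moreover have "\<forall>s. 0 < ?f s" using nonlinearity_pos[OF pos] by blast
  moreover note \<Omega>(1-4)
  moreover have "\<forall>c r. \<Omega> \<noteq> ball c r" using \<Omega>(5) convex_ball by metis
  moreover note \<Omega>(6)
  moreover have "\<Gamma> \<subseteq> frontier \<Omega>" using \<Omega>(9) by (auto simp: \<Gamma>_def)
  moreover have "e \<in> \<Gamma>" using \<Omega>(8) by (simp add: \<Gamma>_def inner_Basis)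
  then have "\<Gamma> \<noteq> {}" by blast
  moreover have "connected \<Gamma>" unfolding \<Gamma>_def by (rule connected_spherical_cap)
  moreover have "open {x. 1 / 2 < x \<bullet> e}" by (intro open_Collect_less continuous_intros)
  then have "openin (top_of_set (frontier \<Omega>)) \<Gamma>"
    unfolding \<Gamma>_def \<Omega>(9)[symmetric] by (rule openin_open_Int)
  moreover have "\<exists>c r. 0 < r \<and> \<Gamma> \<subseteq> sphere c r"
    unfolding \<Gamma>_def by (intro exI[of _ 0] exI[of _ 1]) auto
  moreover have "C2_closure conical \<Omega>"
    using \<Omega>(7) by (intro C2_closureI[where T = "-{0}"] Ck_on_conical) auto
  moreover have "\<forall>x\<in>\<Omega>. - laplacian conical x = ?f (conical x)"
  proof
    fix x assume "x \<in> \<Omega>"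
    then have "\<delta> \<le> norm x" using \<delta>(2) closure_subset by blast
    moreover from this have "x \<noteq> 0" using \<delta>(1) by auto
    ultimately show "- laplacian conical x = ?f (conical x)"
      by (simp add: laplacian_conical nonlinearity_def conical_def m_def max_absorb2 field_simps)
  qed
  moreover have "\<forall>x\<in>frontier \<Omega>. norm (boundary_gradient conical \<Omega> x) = 8"
  proof
    fix x assume x: "x \<in> frontier \<Omega>"
    have "x \<noteq> 0" using \<Omega>(7) x by (auto simp: frontier_def)
    have "continuous_on (-{0}) (\<lambda>x :: real ^ 'n. (- 8 * inverse (norm x)) *\<^sub>R x)"
      by (intro continuous_intros) auto
    then have "continuous_on (-{0}) (gradient (conical :: real ^ 'n \<Rightarrow> real))"
      by (rule continuous_on_eq) (simp add: gradient_conical)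
    then have "boundary_gradient conical \<Omega> x = gradient conical x"
      using \<open>x \<noteq> 0\<close> \<Omega>(1) x by (intro boundary_gradientI[where T = "-{0}"]) auto
    then show "norm (boundary_gradient conical \<Omega> x) = 8"
      using \<open>x \<noteq> 0\<close> by (simp add: gradient_conical)
  qed
  moreover have "\<forall>x\<in>\<Gamma>. conical x = 0" by (simp add: \<Gamma>_def conical_def)
  ultimately show ?thesis
    by - (rule exI[of _ ?f], rule exI[of _ \<Omega>], rule exI[of _ \<Gamma>], rule exI[of _ conical],
        intro conjI)
qed

end
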